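(* Let $\pi=(d_0,d_1,\ldots,d_{n-1})$ be a nonincreasing sequence which is the degree sequence of some tree on $n$ vertices, and let $0\leq \alpha<1$. Then the tree $\mathcal{T}^*_{\pi}$ has the largest $A_\alpha$-spectral radius among all trees with degree sequence $\pi$; that is, $\rho(A_\alpha(\mathcal{T}^*_{\pi}))\geq \rho(A_\alpha(T))$ for every tree $T$ with degree sequence $\pi$.
   Context: All graphs are simple and undirected. For a graph $G$ with adjacency matrix $A(G)$ and diagonal degree matrix $D(G)$, and $\alpha\in[0,1]$, let $A_\alpha(G)=\alpha D(G)+(1-\alpha)A(G)$, and let $\rho(A_\alpha(G))$ denote its spectral radius (largest eigenvalue), called the $A_\alpha$-spectral radius of $G$. The tree $\mathcal{T}^*_{\pi}$ (the breadth-first-search tree with degree sequence $\pi$) is defined as follows: take vertices $v_0,v_1,\ldots,v_{n-1}$; join $v_0$ to $v_1,\ldots,v_{d_0}$; then, for $i=1,2,\ldots$ in increasing order, join $v_i$ to the next $d_i-1$ vertices not yet used, i.e. to $v_{c_i+1},\ldots,v_{c_i+d_i-1}$ where $c_i=d_0+\sum_{j=1}^{i-1}(d_j-1)$. Thus $v_i$ has degree $d_i$ and the vertices are assigned layer by layer (by distance from the root $v_0$), with larger degrees given to earlier vertices. *)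

theory Defs
  imports
    Graph_Theory.Graph_Theory
    Jordan_Normal_Form.Spectral_Radius
    "HOL-Library.Multiset"
begin

text \<open>A finite simple undirected graph is a \<open>pair_graph\<close>: a finite vertex set with a finite,
  symmetric, irreflexive set of arcs, each undirected edge being represented by its two opposite
  arcs. Hence \<open>out_degree\<close> is the usual degree.

  The library's \<open>tree\<close> is unsuitable here: in a symmetric digraph every edge gives the closed walk
  \<open>u, v, u\<close>, which \<open>cycle\<close> accepts. The cycles of the undirected graph are the
  ones of length at least 3.\<close>

definition tree_graph :: "'a pair_pre_digraph \<Rightarrow> bool" where
  "tree_graph G \<longleftrightarrow> pair_graph G \<and> Digraph_Component.connected (with_proj G) \<and>
     \<not> (\<exists>p. pre_digraph.cycle (with_proj G) p \<and> length p \<ge> 3)"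

text \<open>Up to order, the entries of the list are the degrees of the vertices, with multiplicity.\<close>

definition has_degree_sequence :: "'a pair_pre_digraph \<Rightarrow> nat list \<Rightarrow> bool" where
  "has_degree_sequence G \<pi> \<longleftrightarrow>
     mset \<pi> = image_mset (\<lambda>v. out_degree (with_proj G) v) (mset_set (pverts G))"

text \<open>Matrices are indexed by \<open>0, \<dots>, n - 1\<close>, so an enumeration of the vertices has to be chosen. The
  spectrum does not depend on it: another choice permutes rows and columns simultaneously.\<close>

definition vertex_list :: "'a pair_pre_digraph \<Rightarrow> 'a list" where
  "vertex_list G = (SOME vs. distinct vs \<and> set vs = pverts G)"

definition adjacency_mat :: "'a pair_pre_digraph \<Rightarrow> real mat" where
  "adjacency_mat G = (let vs = vertex_list G; n = length vs in
     mat n n (\<lambda>(i, j). if (vs ! i, vs ! j) \<in> parcs G then 1 else 0))"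

definition degree_mat :: "'a pair_pre_digraph \<Rightarrow> real mat" where
  "degree_mat G = (let vs = vertex_list G; n = length vs in
     mat_diag n (\<lambda>i. real (out_degree (with_proj G) (vs ! i))))"

definition A_alpha :: "real \<Rightarrow> 'a pair_pre_digraph \<Rightarrow> real mat" where
  "A_alpha \<alpha> G = \<alpha> \<cdot>\<^sub>m degree_mat G + (1 - \<alpha>) \<cdot>\<^sub>m adjacency_mat G"

definition A_alpha_spectral_radius :: "real \<Rightarrow> 'a pair_pre_digraph \<Rightarrow> real" where
  "A_alpha_spectral_radius \<alpha> G = spectral_radius (map_mat complex_of_real (A_alpha \<alpha> G))"

text \<open>\<open>bfs_offset \<pi> i\<close>, for \<open>i \<ge> 1\<close>, is the last index used once \<open>v\<^sub>0, \<dots>, v\<^sub>i\<^sub>-\<^sub>1\<close> have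
  received their children. Truncated subtraction is harmless: in a tree with at least two vertices
  all degrees are positive.\<close>

definition bfs_offset :: "nat list \<Rightarrow> nat \<Rightarrow> nat" where
  "bfs_offset \<pi> i = \<pi> ! 0 + (\<Sum>j = 1..i - 1. \<pi> ! j - 1)"

definition bfs_children :: "nat list \<Rightarrow> nat \<Rightarrow> nat set" where
  "bfs_children \<pi> i =
     (if i = 0 then {1..\<pi> ! 0} else {bfs_offset \<pi> i + 1..bfs_offset \<pi> i + \<pi> ! i - 1})"

text \<open>The vertex \<open>v\<^sub>i\<close> is the number \<open>i\<close>.\<close>

definition bfs_tree :: "nat list \<Rightarrow> nat pair_pre_digraph" where
  "bfs_tree \<pi> = (let E = {(i, j). i < length \<pi> \<and> j \<in> bfs_children \<pi> i} in
     \<lparr>pverts = {..<length \<pi>}, parcs = E \<union> E\<inverse>\<rparr>)"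

end

theory Submission
  imports Defs
begin

text \<open>
  For a real symmetric matrix with nonnegative entries, the spectral radius is the largest Rayleigh
  quotient, attained at a nonnegative vector \<open>x\<close>. Number the vertices of \<open>T\<close> as
  \<open>u\<^sub>0, u\<^sub>1, \<dots>\<close> so that \<open>x\<close> decreases. By Abel summation in both indices, the quadratic
  form of \<open>A\<^sub>\<alpha>(T)\<close> at \<open>x\<close> is a nonnegative combination of the block sums of \<open>A\<^sub>\<alpha>(T)\<close> over
  \<open>{u\<^sub>0, \<dots>, u\<^sub>s\<^sub>-\<^sub>1} \<times> {u\<^sub>0, \<dots>, u\<^sub>t\<^sub>-\<^sub>1}\<close>. So it suffices that each of these block sums is
  at most the corresponding one of the BFS tree. For \<open>1 \<le> s \<le> t\<close>, the number of arcs of a tree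
  between nested sets of sizes \<open>s\<close> and \<open>t\<close> is at most the degree sum
  \<open>d\<^sub>0 + \<dots> + d\<^sub>s\<^sub>-\<^sub>1\<close>, and at most \<open>s + t - 2\<close> by acyclicity; initial segments of the BFS
  tree attain the smaller of the two bounds.
\<close>

section \<open>Spectral radius and Rayleigh quotients\<close>

lemma spectral_radius_nonneg:
  assumes "A \<in> carrier_mat n n" "n > 0"
  shows "0 \<le> spectral_radius A"
  using spectral_radius_mem_max(1)[OF assms] by auto

text \<open>An eigenvector of the scaled matrix for \<open>ev\<close> is one of \<open>A\<close> for
  \<open>r * ev\<close>, so \<open>r * norm ev\<close> is at most the spectral radius of
  \<open>A\<close>.\<close>

lemma spectral_radius_scale_less_1:
  fixes A :: "complex mat"
  assumes A: "A \<in> carrier_mat n n" and n: "n > 0" and r: "spectral_radius A < r"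
  shows "spectral_radius (complex_of_real (1 / r) \<cdot>\<^sub>m A) < 1"
proof -
  have r0: "0 < r" using spectral_radius_nonneg[OF A n] r by linarith
  have B: "complex_of_real (1 / r) \<cdot>\<^sub>m A \<in> carrier_mat n n" using A by simp
  from spectral_radius_mem_max(1)[OF B n] obtain ev v
    where ev: "spectral_radius (complex_of_real (1 / r) \<cdot>\<^sub>m A) = norm ev"
      and v: "eigenvector (complex_of_real (1 / r) \<cdot>\<^sub>m A) v ev"
    unfolding spectrum_def eigenvalue_def by auto
  have vn: "v \<in> carrier_vec n" "v \<noteq> 0\<^sub>v n"
    and eq: "(complex_of_real (1 / r) \<cdot>\<^sub>m A) *\<^sub>v v = ev \<cdot>\<^sub>v v"
    using v A unfolding eigenvector_def by auto
  have "A *\<^sub>v v = complex_of_real r \<cdot>\<^sub>v ((complex_of_real (1 / r) \<cdot>\<^sub>m A) *\<^sub>v v)"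
    using A vn(1) r0 by (intro eq_vecI) (auto simp: scalar_prod_def sum_distrib_left)
  then have "A *\<^sub>v v = (complex_of_real r * ev) \<cdot>\<^sub>v v"
    unfolding eq by (simp add: smult_smult_assoc)
  then have "eigenvector A v (complex_of_real r * ev)"
    using vn A unfolding eigenvector_def by auto
  then have "norm (complex_of_real r * ev) \<in> norm ` spectrum A"
    unfolding spectrum_def eigenvalue_def by blast
  from spectral_radius_mem_max(2)[OF A n this] have "r * norm ev \<le> spectral_radius A"
    using r0 by (simp add: norm_mult)
  then have "r * norm ev < r * 1" using r by simp
  then have "norm ev < 1" using r0 by (simp only: mult_less_cancel_left_pos)
  then show ?thesis using ev by simp
qed

text \<open>Powers of two serve as exponents because of squaring: for symmetric \<open>P\<close>,
  the form of \<open>P * P\<close> at \<open>x\<close> is the squared length of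
  \<open>P *\<^sub>v x\<close>.\<close>

lemma scalar_prod_pow_growth:
  fixes B :: "real mat"
  assumes B: "B \<in> carrier_mat n n" and sym: "\<And>i j. i < n \<Longrightarrow> j < n \<Longrightarrow> B $$ (i, j) = B $$ (j, i)"
    and x: "x \<in> carrier_vec n" and g: "0 \<le> g"
    and base: "g * (x \<bullet> x) \<le> x \<bullet> (B *\<^sub>v x)"
  shows "g ^ (2 ^ k) * (x \<bullet> x) \<le> x \<bullet> ((B ^\<^sub>m (2 ^ k)) *\<^sub>v x)"
proof -
  have pc: "B ^\<^sub>m m \<in> carrier_mat n n" for m using B by simp
  have BT: "transpose_mat B = B" using B sym by (intro eq_matI) auto
  have comm: "B * B ^\<^sub>m m = B ^\<^sub>m m * B" for m
  proof (induction m)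
    case (Suc m)
    have "B * B ^\<^sub>m Suc m = (B * B ^\<^sub>m m) * B" using assoc_mult_mat[OF B pc B] by simp
    then show ?case using Suc by simp
  qed (use B in auto)
  have powT: "transpose_mat (B ^\<^sub>m m) = B ^\<^sub>m m" for m
    by (induction m) (use B BT comm pc in \<open>auto simp: transpose_mult[of _ n n _ n]\<close>)
  have padd: "B ^\<^sub>m (a + b) = B ^\<^sub>m a * B ^\<^sub>m b" for a b
  proof (induction b)
    case (Suc b)
    then show ?case using assoc_mult_mat[OF pc pc B] by simp
  qed (use B pc right_mult_one_mat[OF pc] in simp)
  show ?thesis
  proof (induction k)
    case 0
    then show ?case using base B by simp
  next
    case (Suc k)
    define P where "P = B ^\<^sub>m (2 ^ k)"
    define w where "w = P *\<^sub>v x"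
    define t where "t = g ^ (2 ^ k)"
    have P: "P \<in> carrier_mat n n" using pc P_def by simp
    have w: "w \<in> carrier_vec n" using P x w_def by simp
    have "B ^\<^sub>m (2 ^ Suc k) = P * P" unfolding P_def using padd[of "2^k" "2^k"] by (simp add: mult_2)
    then have "x \<bullet> ((B ^\<^sub>m (2 ^ Suc k)) *\<^sub>v x) = x \<bullet> (P *\<^sub>v w)"
      using P x unfolding w_def by (simp add: assoc_mult_mat_vec[of _ n n _ n])
    also have "\<dots> = (transpose_mat P *\<^sub>v x) \<bullet> w"
      using P x w by (simp add: transpose_vec_mult_scalar)
    also have "\<dots> = w \<bullet> w" unfolding P_def powT w_def by simp
    finally have eq: "x \<bullet> ((B ^\<^sub>m (2 ^ Suc k)) *\<^sub>v x) = w \<bullet> w" .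
    have t0: "0 \<le> t" using g t_def by simp
    have IH: "t * (x \<bullet> x) \<le> x \<bullet> w" using Suc unfolding t_def w_def P_def .
    \<comment> \<open>Expanding the squared length of \<open>w - t x\<close> bounds
      \<open>w \<bullet> w\<close> below in terms of \<open>x \<bullet> w\<close>, in place of the
      Cauchy-Schwarz inequality.\<close>
    have "0 \<le> (\<Sum>i<n. (w $ i - t * x $ i)\<^sup>2)" by (simp add: sum_nonneg)
    also have "\<dots> = w \<bullet> w - 2 * t * (x \<bullet> w) + t * t * (x \<bullet> x)"
      using w x unfolding scalar_prod_def
      by (simp add: power2_eq_square algebra_simps sum.distrib sum_subtractf sum_distrib_left
          atLeast0LessThan)
    finally have "2 * t * (x \<bullet> w) - t * t * (x \<bullet> x) \<le> w \<bullet> w" by simp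
    moreover have "t * (t * (x \<bullet> x)) \<le> t * (x \<bullet> w)" using IH t0 by (rule mult_left_mono)
    ultimately have "t * t * (x \<bullet> x) \<le> w \<bullet> w" by simp
    moreover have "t * t = g ^ (2 ^ Suc k)" unfolding t_def by (simp add: mult_2 flip: power_add)
    ultimately show ?case using eq by simp
  qed
qed

text \<open>If the Rayleigh quotient \<open>q\<close> were larger, scaling by some \<open>r\<close>
  strictly between the two would give a matrix whose powers stay bounded, while its form at
  \<open>x\<close> grows at least like \<open>(q / r) ^ (2 ^ k)\<close>.\<close>

lemma rayleigh_le_spectral_radius:
  fixes A :: "real mat"
  assumes A: "A \<in> carrier_mat n n" and sym: "\<And>i j. i < n \<Longrightarrow> j < n \<Longrightarrow> A $$ (i, j) = A $$ (j, i)"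
    and x: "x \<in> carrier_vec n"
  shows "x \<bullet> (A *\<^sub>v x) \<le> spectral_radius (map_mat complex_of_real A) * (x \<bullet> x)"
proof (rule ccontr)
  let ?C = "map_mat complex_of_real A"
  assume neg: "\<not> ?thesis"
  have n: "n > 0" using neg A x by (cases "n = 0") (auto simp: scalar_prod_def)
  have C: "?C \<in> carrier_mat n n" using A by simp
  have xx: "x \<bullet> x > 0"
  proof (rule ccontr)
    assume "\<not> x \<bullet> x > 0"
    moreover have "0 \<le> x \<bullet> x" by (simp add: scalar_prod_def sum_nonneg)
    ultimately have "x \<bullet> x = 0" by simp
    then have "x $ i = 0" if "i < n" for i
      using that x by (auto simp: scalar_prod_def sum_nonneg_eq_0_iff)
    then have "x = 0\<^sub>v n" using x by (intro eq_vecI) auto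
    then show False using neg A by auto
  qed
  define q where "q = x \<bullet> (A *\<^sub>v x) / (x \<bullet> x)"
  have "spectral_radius ?C < q" using neg xx unfolding q_def by (simp add: pos_less_divide_eq)
  then obtain r where r: "spectral_radius ?C < r" "r < q" using dense by blast
  have r0: "0 < r" using spectral_radius_nonneg[OF C n] r by linarith
  define B where "B = (1 / r) \<cdot>\<^sub>m A"
  have B: "B \<in> carrier_mat n n" using A B_def by simp
  have CB: "map_mat complex_of_real B = complex_of_real (1 / r) \<cdot>\<^sub>m ?C"
    unfolding B_def using A by (intro eq_matI) auto
  have "spectral_radius (map_mat complex_of_real B) < 1"
    unfolding CB by (rule spectral_radius_scale_less_1[OF C n r(1)])
  \<comment> \<open>Via the Jordan normal form, a spectral radius below 1 bounds the entries of all
    powers by one constant.\<close>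
  from spectral_radius_jnf_norm_bound_less_1_upper_triangular[OF _ this, of n] B
  obtain c where c: "norm_bound (map_mat complex_of_real B ^\<^sub>m k) c" for k by auto
  have bound: "\<bar>(B ^\<^sub>m k) $$ (i, j)\<bar> \<le> c" if "i < n" "j < n" for k i j
  proof -
    have "map_mat complex_of_real B ^\<^sub>m k = map_mat complex_of_real (B ^\<^sub>m k)"
      using of_real_hom.mat_hom_pow[OF B, symmetric] .
    then have "norm_bound (map_mat complex_of_real (B ^\<^sub>m k)) c" using c[of k] by simp
    then have "norm (map_mat complex_of_real (B ^\<^sub>m k) $$ (i, j)) \<le> c"
      using that carrier_matD[OF pow_carrier_mat[OF B, of k]]
      by (simp add: norm_bound_def del: index_map_mat(1))
    then show ?thesis using that carrier_matD[OF pow_carrier_mat[OF B, of k]] by simp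
  qed
  define g where "g = q / r"
  have g: "1 < g" using r r0 unfolding g_def by simp
  have "x \<bullet> (B *\<^sub>v x) = (1 / r) * (x \<bullet> (A *\<^sub>v x))"
    unfolding B_def using A x by (simp add: scalar_prod_def sum_distrib_left sum_divide_distrib mult_ac)
  also have "\<dots> = g * (x \<bullet> x)" unfolding g_def q_def using xx by simp
  finally have base: "g * (x \<bullet> x) \<le> x \<bullet> (B *\<^sub>v x)" by simp
  have symB: "B $$ (i, j) = B $$ (j, i)" if "i < n" "j < n" for i j
    using that A sym[OF that] unfolding B_def by simp
  define S where "S = (\<Sum>i<n. \<Sum>j<n. \<bar>x $ i\<bar> * (c * \<bar>x $ j\<bar>))"
  have upper: "x \<bullet> ((B ^\<^sub>m k) *\<^sub>v x) \<le> S" for k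
  proof -
    define P where "P = B ^\<^sub>m k"
    have P: "P \<in> carrier_mat n n" unfolding P_def using B by simp
    have "x \<bullet> (P *\<^sub>v x) = (\<Sum>i<n. \<Sum>j<n. x $ i * (P $$ (i, j) * x $ j))"
      using x P
      by (simp add: scalar_prod_def sum_distrib_left atLeast0LessThan)
    also have "\<dots> \<le> S" unfolding S_def
    proof (intro sum_mono)
      fix i j assume ij: "i \<in> {..<n}" "j \<in> {..<n}"
      have "x $ i * (P $$ (i, j) * x $ j) \<le> \<bar>x $ i\<bar> * (\<bar>P $$ (i, j)\<bar> * \<bar>x $ j\<bar>)"
        by (metis abs_ge_self abs_mult)
      also have "\<dots> \<le> \<bar>x $ i\<bar> * (c * \<bar>x $ j\<bar>)"
        using bound[of _ _ k, folded P_def] ij by (intro mult_left_mono mult_right_mono) auto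
      finally show "x $ i * (P $$ (i, j) * x $ j) \<le> \<bar>x $ i\<bar> * (c * \<bar>x $ j\<bar>)" .
    qed
    finally show ?thesis unfolding P_def .
  qed
  obtain m where m: "S / (x \<bullet> x) < g ^ m" using real_arch_pow[OF g] by blast
  \<comment> \<open>The growth bound is stated at exponents \<open>2 ^ k\<close>, so a large enough
    \<open>m\<close> is replaced by \<open>2 ^ m\<close>.\<close>
  have "m \<le> 2 ^ m" by (simp add: less_imp_le)
  then have "g ^ m \<le> g ^ (2 ^ m)" using g by (intro power_increasing) auto
  have "S < g ^ m * (x \<bullet> x)" using m xx by (simp add: pos_divide_less_eq)
  also have "\<dots> \<le> g ^ (2 ^ m) * (x \<bullet> x)" using \<open>g ^ m \<le> g ^ (2 ^ m)\<close> xx by simp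
  also have "\<dots> \<le> x \<bullet> ((B ^\<^sub>m (2 ^ m)) *\<^sub>v x)"
    using scalar_prod_pow_growth[OF B symB x _ base] g by simp
  also have "\<dots> \<le> S" by (rule upper)
  finally show False by simp
qed

text \<open>The witness consists of the moduli of the entries of an eigenvector for an eigenvalue of
  largest modulus: as \<open>A\<close> has nonnegative entries, the triangle inequality gives
  \<open>norm ev * x $ i \<le> (A *\<^sub>v x) $ i\<close>.\<close>

lemma spectral_radius_le_rayleigh:
  fixes A :: "real mat"
  assumes A: "A \<in> carrier_mat n n" and n: "n > 0"
    and nonneg: "\<And>i j. i < n \<Longrightarrow> j < n \<Longrightarrow> 0 \<le> A $$ (i, j)"
  shows "\<exists>x \<in> carrier_vec n. (\<forall>i<n. 0 \<le> x $ i) \<and> 0 < x \<bullet> x \<and>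
    spectral_radius (map_mat complex_of_real A) * (x \<bullet> x) \<le> x \<bullet> (A *\<^sub>v x)"
proof -
  let ?C = "map_mat complex_of_real A"
  have C: "?C \<in> carrier_mat n n" using A by simp
  from spectral_radius_mem_max(1)[OF C n] obtain ev v
    where ev: "spectral_radius ?C = norm ev" and v: "eigenvector ?C v ev"
    unfolding spectrum_def eigenvalue_def by auto
  have vn: "v \<in> carrier_vec n" "v \<noteq> 0\<^sub>v n" and eq: "?C *\<^sub>v v = ev \<cdot>\<^sub>v v"
    using v A unfolding eigenvector_def by auto
  define x where "x = vec n (\<lambda>i. norm (v $ i))"
  have xc: "x \<in> carrier_vec n" by (simp add: x_def)
  have row: "norm ev * x $ i \<le> (A *\<^sub>v x) $ i" if "i < n" for i
  proof -
    have "ev * v $ i = (?C *\<^sub>v v) $ i" unfolding eq using that vn by simp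
    also have "\<dots> = (\<Sum>j<n. complex_of_real (A $$ (i, j)) * v $ j)"
      using that vn A by (simp add: scalar_prod_def atLeast0LessThan)
    finally have "norm (ev * v $ i) \<le> (\<Sum>j<n. norm (complex_of_real (A $$ (i, j)) * v $ j))"
      by (metis norm_sum)
    also have "\<dots> = (A *\<^sub>v x) $ i"
      using that nonneg A by (simp add: scalar_prod_def atLeast0LessThan x_def norm_mult)
    finally show ?thesis using that by (simp add: x_def norm_mult)
  qed
  have "spectral_radius ?C * (x \<bullet> x) = (\<Sum>i<n. x $ i * (norm ev * x $ i))"
    using xc ev by (simp add: scalar_prod_def sum_distrib_left atLeast0LessThan mult_ac)
  also have "\<dots> \<le> (\<Sum>i<n. x $ i * (A *\<^sub>v x) $ i)"
    using row by (intro sum_mono mult_left_mono) (auto simp: x_def)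
  also have "\<dots> = x \<bullet> (A *\<^sub>v x)" using A by (simp add: scalar_prod_def atLeast0LessThan)
  finally have le: "spectral_radius ?C * (x \<bullet> x) \<le> x \<bullet> (A *\<^sub>v x)" .
  obtain i where i: "i < n" "v $ i \<noteq> 0" using vn by (metis carrier_vecD eq_vecI index_zero_vec)
  have "0 < x $ i * x $ i" using i by (simp add: x_def)
  also have "\<dots> \<le> x \<bullet> x"
    unfolding scalar_prod_def using i xc by (intro member_le_sum) auto
  finally have "0 < x \<bullet> x" .
  with le xc show ?thesis by (intro bexI[of _ x]) (auto simp: x_def)
qed

section \<open>Arcs of a tree between vertex sets\<close>

lemma (in pair_graph) arcs_commute: "(u, v) \<in> parcs G \<longleftrightarrow> (v, u) \<in> parcs G"
  by (metis arcs_symmetric)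

text \<open>Ordered pairs are kept, so an edge with both ends in \<open>S \<inter> U\<close> counts
  twice, just as in the sum of adjacency entries over the block \<open>S \<times> U\<close>.\<close>

definition arcs_between :: "'a rel \<Rightarrow> 'a set \<Rightarrow> 'a set \<Rightarrow> 'a rel" where
  "arcs_between E S U = E \<inter> S \<times> U"

lemma finite_arcs_between [simp]: "finite S \<Longrightarrow> finite U \<Longrightarrow> finite (arcs_between E S U)"
  by (simp add: arcs_between_def)

text \<open>Translates vertex lists into arc lists, the form in which walks and cycles are
  expressed.\<close>

lemma pawalk_of_vertices:
  assumes "vs \<noteq> []"
  shows "pawalk_verts (hd vs) (zip vs (tl vs)) = vs" "pcas (hd vs) (zip vs (tl vs)) (last vs)"
  using assms by (induction vs rule: induct_list012) auto

text \<open>Longest path argument. If all vertices had two neighbours in \<open>U\<close>, take a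
  longest path in \<open>U\<close> (\<open>Q\<close> describes these). The
  \<open>U\<close>-neighbours of its first vertex all lie on it, and one that is not the second
  vertex closes a cycle.\<close>

lemma tree_has_leaf_in_subset:
  assumes T: "tree_graph G" and U: "U \<subseteq> pverts G" "U \<noteq> {}"
  shows "\<exists>v\<in>U. card {u \<in> U. (v, u) \<in> parcs G} \<le> 1"
proof (rule ccontr)
  interpret pair_graph G using T by (simp add: tree_graph_def)
  assume "\<not> ?thesis"
  then have deg: "2 \<le> card {u \<in> U. (v, u) \<in> parcs G}" if "v \<in> U" for v
    using that by (metis not_less_eq_eq numeral_2_eq_2 One_nat_def)
  have fin: "finite U" using finite_subset[OF U(1) pair_finite_verts] .
  define Q where "Q vs \<longleftrightarrow> vs \<noteq> [] \<and> distinct vs \<and> set vs \<subseteq> U \<and> set (zip vs (tl vs)) \<subseteq> parcs G" for vs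
  have bound: "length vs \<le> card U" if "Q vs" for vs
    using that fin card_mono[of U "set vs"] distinct_card[of vs] unfolding Q_def by auto
  obtain u where "u \<in> U" using U by blast
  then have "Q [u]" by (simp add: Q_def)
  with bound obtain vs where vs: "Q vs" and maximal: "\<And>ws. Q ws \<Longrightarrow> length ws \<le> length vs"
    using ex_has_greatest_nat[of Q "[u]" length "Suc (card U)"] by (metis less_Suc_eq_le)
  obtain v rest where vs_eq: "vs = v # rest" using vs by (cases vs) (auto simp: Q_def)
  have vU: "v \<in> U" using vs by (simp add: Q_def vs_eq)
  define N where "N = {u \<in> U. (v, u) \<in> parcs G}"
  have N_rest: "N \<subseteq> set rest"
  proof
    fix w assume w: "w \<in> N"
    show "w \<in> set rest"
    proof (rule ccontr)
      assume "w \<notin> set rest"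
      moreover have "w \<noteq> v" using w no_loops' by (auto simp: N_def)
      ultimately have "Q (w # vs)" using vs w arcs_commute[of w v] by (auto simp: Q_def vs_eq N_def)
      then show False using maximal by fastforce
    qed
  qed
  have "\<not> N \<subseteq> {hd rest}"
    using deg[OF vU] card_mono[of "{hd rest}" N] by (auto simp: N_def)
  then obtain w where w: "w \<in> N" "w \<noteq> hd rest" by blast
  then obtain as bs where split: "rest = as @ w # bs" using N_rest split_list by fast
  have as: "as \<noteq> []" using w split by auto
  \<comment> \<open>The path from \<open>v\<close> to its neighbour \<open>w\<close>, closed by the
    arc \<open>(w, v)\<close>. Since \<open>as\<close> is nonempty, the cycle has at least 3 arcs
    and is not an edge traversed back and forth.\<close>
  define c where "c = w # v # as @ [w]"
  let ?p = "zip c (tl c)"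
  have "zip vs (tl vs) = zip (v # as) (as @ [w]) @ zip (w # bs) bs"
    using zip_append[of "v # as" "as @ [w]" "w # bs" bs] by (simp add: vs_eq split)
  moreover have "zip (v # as @ [w]) (as @ [w]) = zip (v # as) (as @ [w])"
    using zip_append[of "v # as" "as @ [w]" "[w]" "[]"] by simp
  ultimately have "set (zip (v # as @ [w]) (as @ [w])) \<subseteq> set (zip vs (tl vs))" by simp
  then have arcs: "set ?p \<subseteq> parcs G"
    using vs w arcs_commute[of w v] by (auto simp: c_def Q_def N_def)
  have "pawalk_verts w ?p = c" "pcas w ?p w"
    using pawalk_of_vertices[of c] by (auto simp: c_def)
  moreover have "distinct (tl c)" using vs by (auto simp: c_def Q_def vs_eq split)
  moreover have "w \<in> pverts G" using w U by (auto simp: N_def)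
  ultimately have "cycle ?p" using arcs
    by (auto simp: cycle_def awalk_def c_def)
  moreover have "length ?p \<ge> 3" using as by (cases as) (auto simp: c_def)
  ultimately show False using T unfolding tree_graph_def by blast
qed

text \<open>Each neighbour \<open>u\<close> of \<open>v\<close> contributes \<open>(v, u)\<close>
  and \<open>(u, v)\<close>; irreflexivity keeps the two families disjoint.\<close>

lemma arcs_between_remove_vertex:
  assumes fin: "finite U" and v: "v \<in> U" and sym: "sym E" and irrefl: "irrefl E"
  shows "card (arcs_between E U U) = card (arcs_between E (U - {v}) (U - {v})) + 2 * card {u \<in> U. (v, u) \<in> E}"
proof -
  let ?N = "{u \<in> U. (v, u) \<in> E}"
  have split: "arcs_between E U U =
      arcs_between E (U - {v}) (U - {v}) \<union> (Pair v ` ?N \<union> (\<lambda>u. (u, v)) ` ?N)"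
    using v sym irrefl by (auto simp: arcs_between_def dest: symD)
  have "card (Pair v ` ?N \<union> (\<lambda>u. (u, v)) ` ?N) = card (Pair v ` ?N) + card ((\<lambda>u. (u, v)) ` ?N)"
    using fin irrefl by (intro card_Un_disjoint) (auto simp: irrefl_def)
  also have "\<dots> = 2 * card ?N" by (simp add: card_image inj_on_def)
  finally have N: "card (Pair v ` ?N \<union> (\<lambda>u. (u, v)) ` ?N) = 2 * card ?N" .
  show ?thesis unfolding split N[symmetric]
    using fin by (intro card_Un_disjoint) (auto simp: arcs_between_def)
qed

lemma (in pair_graph) sym_irrefl: "sym (parcs G)" "irrefl (parcs G)"
  by (metis symI arcs_symmetric) (metis irreflI no_loops')

text \<open>Removing a vertex with at most one neighbour in \<open>U\<close> loses at most two arcs.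
  Adding 2 on the left avoids truncated subtraction.\<close>

lemma tree_arcs_within:
  assumes T: "tree_graph G"
  shows "U \<subseteq> pverts G \<Longrightarrow> U \<noteq> {} \<Longrightarrow> card (arcs_between (parcs G) U U) + 2 \<le> 2 * card U"
proof (induction "card U" arbitrary: U)
  case 0
  interpret pair_graph G using T by (simp add: tree_graph_def)
  show ?case using 0 pair_finite_verts finite_subset by fastforce
next
  case (Suc m)
  interpret pair_graph G using T by (simp add: tree_graph_def)
  have fin: "finite U" using Suc.hyps card.infinite by fastforce
  obtain v where v: "v \<in> U" "card {u \<in> U. (v, u) \<in> parcs G} \<le> 1"
    using tree_has_leaf_in_subset[OF T Suc.prems] by blast
  have cU: "card (U - {v}) = m" using v fin Suc.hyps by simp
  show ?case
  proof (cases "U - {v} = {}")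
    case True
    then have "U = {v}" using v by auto
    then show ?thesis using sym_irrefl by (auto simp: arcs_between_def irrefl_def)
  next
    case False
    then have "card (arcs_between (parcs G) (U - {v}) (U - {v})) + 2 \<le> 2 * m"
      using Suc.hyps(1)[of "U - {v}"] cU Suc.prems by auto
    then show ?thesis
      using arcs_between_remove_vertex[OF fin v(1) sym_irrefl] v(2) Suc.hyps(2) by linarith
  qed
qed

text \<open>Twice the number of arcs from \<open>S\<close> to \<open>U\<close> is at most the number within \<open>S\<close> plus the
  number within \<open>U\<close>.\<close>

lemma tree_arcs_between:
  assumes T: "tree_graph G" and U: "U \<subseteq> pverts G" and S: "S \<subseteq> U" "S \<noteq> {}"
  shows "card (arcs_between (parcs G) S U) + 2 \<le> card S + card U"
proof -
  interpret pair_graph G using T by (simp add: tree_graph_def)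
  let ?B = "arcs_between (parcs G)"
  have finU: "finite U" using finite_subset[OF U pair_finite_verts] .
  have fin: "finite U" "finite S" using finU finite_subset[OF S(1) finU] by auto
  have "?B S U = ?B S S \<union> ?B S (U - S)" using S by (auto simp: arcs_between_def)
  then have SU: "card (?B S U) = card (?B S S) + card (?B S (U - S))"
    using fin by (simp only:) (intro card_Un_disjoint; auto simp: arcs_between_def)
  have "?B (U - S) S = (?B S (U - S))\<inverse>"
    unfolding arcs_between_def by (blast intro: arcs_symmetric)
  then have sym: "card (?B (U - S) S) = card (?B S (U - S))" by (simp add: card_inverse)
  have "card (?B S S) + card (?B S (U - S)) + card (?B (U - S) S)
      = card (?B S S \<union> ?B S (U - S) \<union> ?B (U - S) S)"
    using fin by (subst card_Un_disjoint; (subst card_Un_disjoint)?; auto simp: arcs_between_def)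
  also have "\<dots> \<le> card (?B U U)"
    using fin S by (intro card_mono) (auto simp: arcs_between_def)
  finally have "card (?B S S) + 2 * card (?B S (U - S)) \<le> card (?B U U)" using sym by simp
  moreover have "card (?B S S) + 2 \<le> 2 * card S" using tree_arcs_within[OF T] S U by blast
  moreover have "card (?B U U) + 2 \<le> 2 * card U" using tree_arcs_within[OF T] S U by blast
  ultimately show ?thesis using SU by linarith
qed

section \<open>Degrees, connectedness and degree sequences\<close>

lemma (in pair_graph) finite_neighbours: "finite {u. (v, u) \<in> parcs G}"
  by (rule finite_subset[OF _ pair_finite_verts]) (blast dest: in_arcsD2)

lemma (in pair_graph) out_degree_eq_card: "out_degree (with_proj G) v = card {u. (v, u) \<in> parcs G}"
proof -
  have "out_arcs (with_proj G) v = Pair v ` {u. (v, u) \<in> parcs G}"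
    by (auto simp: out_arcs_def)
  then show ?thesis by (simp add: out_degree_def card_image inj_on_def)
qed

lemma (in pair_graph) sum_out_degree:
  assumes "S \<subseteq> pverts G"
  shows "(\<Sum>v\<in>S. out_degree (with_proj G) v) = card (arcs_between (parcs G) S (pverts G))"
proof -
  have "arcs_between (parcs G) S (pverts G) = Sigma S (\<lambda>v. {u. (v, u) \<in> parcs G})"
    using in_arcsD2 by (auto simp: arcs_between_def)
  moreover have "finite {u. (v, u) \<in> parcs G}" for v
    by (rule finite_neighbours)
  moreover have "finite S" using finite_subset[OF assms pair_finite_verts] .
  ultimately show ?thesis by (simp add: out_degree_eq_card)
qed

text \<open>If no arc left \<open>S\<close>, then by induction along a walk nothing outside
  \<open>S\<close> would be reachable from \<open>S\<close>.\<close>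

lemma connected_leaving_arc:
  assumes G: "pair_graph G" and con: "Digraph_Component.connected (with_proj G)"
    and S: "S \<subseteq> pverts G" "S \<noteq> {}" "S \<noteq> pverts G"
  shows "\<exists>u\<in>S. \<exists>v\<in>pverts G - S. (u, v) \<in> parcs G"
proof (rule ccontr)
  interpret pair_graph G by fact
  assume neg: "\<not> ?thesis"
  obtain a b where ab: "a \<in> S" "b \<in> pverts G - S" using S by auto
  \<comment> \<open>Connectedness refers to the symmetric closure, which adds no arcs here.\<close>
  have "parcs (mk_symmetric (with_proj G)) = parcs G"
    by (force simp: mk_symmetric_def arcs_commute)
  then have "(a, b) \<in> rtrancl_on (pverts G) (parcs G)"
    using con ab S
    by (auto simp: connected_def strongly_connected_def reachable_def mk_symmetric_def)
  then have "b \<in> S"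
    by (induction rule: rtrancl_on_induct) (use ab neg in blast)+
  then show False using ab by blast
qed

text \<open>\<open>S\<close> grows from a single vertex along leaving arcs; each new vertex brings
  at least one edge, hence two arcs.\<close>

lemma connected_arcs_within:
  assumes G: "pair_graph G" and con: "Digraph_Component.connected (with_proj G)"
    and k: "1 \<le> k" "k \<le> card (pverts G)"
  shows "\<exists>S \<subseteq> pverts G. card S = k \<and> 2 * k \<le> card (arcs_between (parcs G) S S) + 2"
  using k
proof (induction k rule: dec_induct)
  case base
  then obtain v where "v \<in> pverts G" by fastforce
  then show ?case by (intro exI[of _ "{v}"]) auto
next
  case (step k)
  interpret pair_graph G by fact
  obtain S where S: "S \<subseteq> pverts G" "card S = k" "2 * k \<le> card (arcs_between (parcs G) S S) + 2"
    using step by auto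
  have fin: "finite S" using finite_subset[OF S(1) pair_finite_verts] .
  have "S \<noteq> {}" "S \<noteq> pverts G" using S step by auto
  then obtain u v where uv: "u \<in> S" "v \<in> pverts G - S" "(u, v) \<in> parcs G"
    using connected_leaving_arc[OF G con S(1)] by blast
  have "u \<in> {u \<in> insert v S. (v, u) \<in> parcs G}" using uv arcs_commute[of u v] by auto
  then have "1 \<le> card {u \<in> insert v S. (v, u) \<in> parcs G}"
    using fin by (auto simp: Suc_le_eq card_gt_0_iff)
  moreover have "insert v S - {v} = S" using uv by auto
  ultimately have "card (arcs_between (parcs G) S S) + 2
      \<le> card (arcs_between (parcs G) (insert v S) (insert v S))"
    using arcs_between_remove_vertex[of "insert v S" v "parcs G"] fin sym_irrefl by simp
  then show ?case using S uv fin by (intro exI[of _ "insert v S"]) auto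
qed

lemma connected_nonempty: "Digraph_Component.connected (with_proj G) \<Longrightarrow> pverts G \<noteq> {}"
  by (auto simp: connected_def strongly_connected_def mk_symmetric_def)

text \<open>On the whole vertex set the upper bound from acyclicity meets the lower bound from
  connectedness.\<close>

lemma tree_sum_out_degree:
  assumes T: "tree_graph G"
  shows "(\<Sum>v\<in>pverts G. out_degree (with_proj G) v) + 2 = 2 * card (pverts G)"
proof -
  have G: "pair_graph G" and con: "Digraph_Component.connected (with_proj G)"
    using T by (auto simp: tree_graph_def)
  interpret pair_graph G by fact
  have ne: "pverts G \<noteq> {}" using connected_nonempty[OF con] .
  then have "1 \<le> card (pverts G)" using pair_finite_verts by (simp add: Suc_le_eq card_gt_0_iff)
  then obtain S where S: "S \<subseteq> pverts G" "card S = card (pverts G)"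
    "2 * card (pverts G) \<le> card (arcs_between (parcs G) S S) + 2"
    using connected_arcs_within[OF G con] by blast
  then have "S = pverts G" using pair_finite_verts card_subset_eq by blast
  then show ?thesis
    using S tree_arcs_within[OF T subset_refl ne] sum_out_degree[OF subset_refl] by simp
qed

lemma tree_out_degree_pos:
  assumes T: "tree_graph G" and v: "v \<in> pverts G" and n: "2 \<le> card (pverts G)"
  shows "1 \<le> out_degree (with_proj G) v"
proof -
  have G: "pair_graph G" and con: "Digraph_Component.connected (with_proj G)"
    using T by (auto simp: tree_graph_def)
  interpret pair_graph G by fact
  have "{v} \<noteq> pverts G"
  proof
    assume "{v} = pverts G"
    then have "pverts G = {v}" by simp
    then show False using n by simp
  qed
  then obtain u where u: "(v, u) \<in> parcs G" using connected_leaving_arc[OF G con, of "{v}"] v by auto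
  have "finite {u. (v, u) \<in> parcs G}" by (rule finite_neighbours)
  with u show ?thesis by (auto simp: out_degree_eq_card Suc_le_eq card_gt_0_iff)
qed

text \<open>Equality of multisets yields a permutation \<open>p\<close> of the positions in
  \<open>\<pi>\<close>; \<open>g\<close> is \<open>p\<close> after the position \<open>q\<close> of
  a vertex in an enumeration.\<close>

lemma degree_sequence_bij:
  assumes fin: "finite (pverts G)" and seq: "has_degree_sequence G \<pi>"
  shows "\<exists>g. bij_betw g (pverts G) {..<length \<pi>} \<and>
    (\<forall>v\<in>pverts G. out_degree (with_proj G) v = \<pi> ! g v)"
proof -
  obtain vs where vs: "distinct vs" "set vs = pverts G" using finite_distinct_list[OF fin] by blast
  let ?d = "out_degree (with_proj G)"
  have ms: "mset (map ?d vs) = mset \<pi>"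
    using seq vs by (simp add: has_degree_sequence_def mset_set_set[symmetric])
  then obtain p where p: "p permutes {..<length \<pi>}" "permute_list p \<pi> = map ?d vs"
    by (metis mset_eq_permutation)
  have len: "length vs = length \<pi>" using ms by (metis length_map size_mset)
  have nth: "bij_betw (nth vs) {..<length \<pi>} (pverts G)" using bij_betw_nth vs len by metis
  define q where "q = the_inv_into {..<length \<pi>} (nth vs)"
  have q: "bij_betw q (pverts G) {..<length \<pi>}"
    unfolding q_def by (rule bij_betw_the_inv_into[OF nth])
  have nth_q: "vs ! q v = v" if "v \<in> pverts G" for v
    unfolding q_def using f_the_inv_into_f_bij_betw[OF nth] that by blast
  have d: "?d (vs ! i) = \<pi> ! p i" if "i < length \<pi>" for i
    using that p len permute_list_nth[OF p(1) that] by (metis nth_map)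
  have "?d v = \<pi> ! (p \<circ> q) v" if "v \<in> pverts G" for v
    using d[of "q v"] nth_q[OF that] bij_betwE[OF q] that by auto
  moreover have "bij_betw (p \<circ> q) (pverts G) {..<length \<pi>}"
    by (rule bij_betw_trans[OF q permutes_imp_bij[OF p(1)]])
  ultimately show ?thesis by blast
qed

lemma tree_degree_sequence:
  assumes T: "tree_graph G" and seq: "has_degree_sequence G \<pi>"
  shows "length \<pi> = card (pverts G)" "1 \<le> length \<pi>" "(\<Sum>i<length \<pi>. \<pi> ! i) + 2 = 2 * length \<pi>"
    "2 \<le> length \<pi> \<Longrightarrow> i < length \<pi> \<Longrightarrow> 1 \<le> \<pi> ! i"
proof -
  interpret pair_graph G using T by (simp add: tree_graph_def)
  obtain g where g: "bij_betw g (pverts G) {..<length \<pi>}"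
    "\<And>v. v \<in> pverts G \<Longrightarrow> out_degree (with_proj G) v = \<pi> ! g v"
    using degree_sequence_bij[OF pair_finite_verts seq] by blast
  show len: "length \<pi> = card (pverts G)" using bij_betw_same_card[OF g(1)] by simp
  have "pverts G \<noteq> {}" using T connected_nonempty by (auto simp: tree_graph_def)
  then show "1 \<le> length \<pi>" using pair_finite_verts len by (simp add: Suc_le_eq card_gt_0_iff)
  have "(\<Sum>i<length \<pi>. \<pi> ! i) = (\<Sum>v\<in>pverts G. out_degree (with_proj G) v)"
    using sum.reindex_bij_betw[OF g(1), of "nth \<pi>"] g(2) by simp
  then show "(\<Sum>i<length \<pi>. \<pi> ! i) + 2 = 2 * length \<pi>"
    using tree_sum_out_degree[OF T] len by simp
  assume "2 \<le> length \<pi>" "i < length \<pi>"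
  moreover from this obtain v where "v \<in> pverts G" "i = g v"
    using g(1) by (metis bij_betw_def imageE lessThan_iff)
  ultimately show "1 \<le> \<pi> ! i" using tree_out_degree_pos[OF T, of v] g(2) len by auto
qed

text \<open>Induction by removing the maximum: a set of \<open>m + 1\<close> natural numbers has
  maximum at least \<open>m\<close>, where \<open>f\<close> is at most \<open>f m\<close>.\<close>

lemma sum_antimono_on_le_initial:
  fixes f :: "nat \<Rightarrow> nat"
  assumes anti: "\<And>i j. i \<le> j \<Longrightarrow> j < n \<Longrightarrow> f j \<le> f i"
  shows "A \<subseteq> {..<n} \<Longrightarrow> sum f A \<le> sum f {..<card A}"
proof (induction "card A" arbitrary: A)
  case 0
  then show ?case using finite_subset by fastforce
next
  case (Suc m)
  have fin: "finite A" using Suc.hyps card.infinite by fastforce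
  then have A: "A \<noteq> {}" using Suc.hyps by auto
  let ?M = "Max A"
  have M: "?M \<in> A" using fin A by simp
  have cA: "card (A - {?M}) = m" using fin M Suc.hyps by simp
  have "A - {?M} \<subseteq> {..<?M}" using fin by (auto simp: less_le)
  then have "m \<le> ?M" using card_mono[of "{..<?M}"] cA by fastforce
  then have fM: "f ?M \<le> f m" using anti M Suc.prems by auto
  have "sum f A = f ?M + sum f (A - {?M})" using fin M by (simp add: sum.remove)
  also have "\<dots> \<le> f m + sum f {..<m}"
    using fM Suc.hyps(1)[of "A - {?M}"] cA Suc.prems by (intro add_mono) auto
  also have "\<dots> = sum f {..<card A}" using Suc.hyps(2)[symmetric] by simp
  finally show ?case .
qed

lemma sum_out_degree_le_initial:
  assumes fin: "finite (pverts G)" and seq: "has_degree_sequence G \<pi>"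
    and mono: "sorted_wrt (\<ge>) \<pi>" and S: "S \<subseteq> pverts G"
  shows "(\<Sum>v\<in>S. out_degree (with_proj G) v) \<le> (\<Sum>i<card S. \<pi> ! i)"
proof -
  obtain g where g: "bij_betw g (pverts G) {..<length \<pi>}"
    "\<And>v. v \<in> pverts G \<Longrightarrow> out_degree (with_proj G) v = \<pi> ! g v"
    using degree_sequence_bij[OF fin seq] by blast
  have inj: "inj_on g S" using g(1) S by (metis bij_betw_imp_inj_on inj_on_subset)
  have "(\<Sum>v\<in>S. out_degree (with_proj G) v) = sum (nth \<pi>) (g ` S)"
    using S g(2) by (auto simp: sum.reindex[OF inj] intro!: sum.cong)
  also have "\<dots> \<le> sum (nth \<pi>) {..<card (g ` S)}"
  proof (rule sum_antimono_on_le_initial)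
    show "g ` S \<subseteq> {..<length \<pi>}" using g(1) S by (auto simp: bij_betw_def)
    show "\<pi> ! j \<le> \<pi> ! i" if "i \<le> j" "j < length \<pi>" for i j
      using that sorted_wrt_nth_less[OF mono, of i j] by (cases "i = j") auto
  qed
  also have "card (g ` S) = card S" by (rule card_image[OF inj])
  finally show ?thesis .
qed

section \<open>The quadratic form of \<open>A\<^sub>\<alpha>\<close>\<close>

text \<open>The entries of the matrix indexed by vertices instead of positions, so that the chosen
  enumeration disappears from the quadratic form.\<close>

definition alpha_weight :: "real \<Rightarrow> 'a pair_pre_digraph \<Rightarrow> 'a \<Rightarrow> 'a \<Rightarrow> real" where
  "alpha_weight \<alpha> G u v = \<alpha> * (if u = v then real (out_degree (with_proj G) u) else 0) +
     (1 - \<alpha>) * (if (u, v) \<in> parcs G then 1 else 0)"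

lemma vertex_list:
  assumes "finite (pverts G)"
  shows "distinct (vertex_list G)" "set (vertex_list G) = pverts G"
  using someI_ex[OF finite_distinct_list[OF assms]] unfolding vertex_list_def
  by (auto simp: conj_commute)

lemma A_alpha_carrier:
  assumes "finite (pverts G)"
  shows "A_alpha \<alpha> G \<in> carrier_mat (card (pverts G)) (card (pverts G))"
  using vertex_list[OF assms] distinct_card[of "vertex_list G"]
  by (simp add: A_alpha_def degree_mat_def adjacency_mat_def mat_diag_def Let_def)

lemma A_alpha_index:
  assumes fin: "finite (pverts G)" and ij: "i < card (pverts G)" "j < card (pverts G)"
  shows "A_alpha \<alpha> G $$ (i, j) = alpha_weight \<alpha> G (vertex_list G ! i) (vertex_list G ! j)"
proof -
  have n: "length (vertex_list G) = card (pverts G)"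
    using vertex_list[OF fin] distinct_card by metis
  then have "vertex_list G ! i = vertex_list G ! j \<longleftrightarrow> i = j"
    using ij vertex_list[OF fin] by (simp add: nth_eq_iff_index_eq)
  then show ?thesis using ij n
    by (simp add: A_alpha_def degree_mat_def adjacency_mat_def mat_diag_def Let_def alpha_weight_def)
qed

lemma bij_betw_vertex_list:
  assumes "finite (pverts G)"
  shows "bij_betw (nth (vertex_list G)) {..<card (pverts G)} (pverts G)"
  using vertex_list[OF assms] bij_betw_nth[of "vertex_list G" "{..<card (pverts G)}" "pverts G"]
  by (metis distinct_card)

lemma A_alpha_quadratic_form:
  assumes fin: "finite (pverts G)"
  shows "vec (card (pverts G)) (\<lambda>i. f (vertex_list G ! i)) \<bullet>
      (A_alpha \<alpha> G *\<^sub>v vec (card (pverts G)) (\<lambda>i. f (vertex_list G ! i))) =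
    (\<Sum>u\<in>pverts G. \<Sum>v\<in>pverts G. alpha_weight \<alpha> G u v * (f u * f v))"
proof -
  have "vec (card (pverts G)) (\<lambda>i. f (vertex_list G ! i)) \<bullet>
      (A_alpha \<alpha> G *\<^sub>v vec (card (pverts G)) (\<lambda>i. f (vertex_list G ! i))) =
    (\<Sum>i<card (pverts G). \<Sum>j<card (pverts G).
      alpha_weight \<alpha> G (vertex_list G ! i) (vertex_list G ! j) * (f (vertex_list G ! i) * f (vertex_list G ! j)))"
    using A_alpha_carrier[OF fin, of \<alpha>]
    by (simp add: scalar_prod_def atLeast0LessThan A_alpha_index[OF fin] sum_distrib_left mult_ac)
  also have "\<dots> = (\<Sum>u\<in>pverts G. \<Sum>v\<in>pverts G. alpha_weight \<alpha> G u v * (f u * f v))"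
    by (simp add: sum.reindex_bij_betw[OF bij_betw_vertex_list[OF fin], symmetric])
  finally show ?thesis .
qed

lemma vertex_list_norm:
  fixes f :: "'a \<Rightarrow> real"
  assumes fin: "finite (pverts G)"
  shows "vec (card (pverts G)) (\<lambda>i. f (vertex_list G ! i)) \<bullet>
      vec (card (pverts G)) (\<lambda>i. f (vertex_list G ! i)) = (\<Sum>u\<in>pverts G. (f u)\<^sup>2)"
  by (simp add: scalar_prod_def atLeast0LessThan power2_eq_square
      sum.reindex_bij_betw[OF bij_betw_vertex_list[OF fin], symmetric])

lemma alpha_form_le_spectral_radius:
  assumes "pair_graph G"
  shows "(\<Sum>u\<in>pverts G. \<Sum>v\<in>pverts G. alpha_weight \<alpha> G u v * (f u * f v))
    \<le> A_alpha_spectral_radius \<alpha> G * (\<Sum>u\<in>pverts G. (f u)\<^sup>2)"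
proof -
  interpret pair_graph G by fact
  have "alpha_weight \<alpha> G u v = alpha_weight \<alpha> G v u" for u v
    unfolding alpha_weight_def arcs_commute[of u v] by simp
  then show ?thesis
    unfolding A_alpha_spectral_radius_def A_alpha_quadratic_form[OF pair_finite_verts, symmetric]
      vertex_list_norm[OF pair_finite_verts, symmetric]
    by (intro rayleigh_le_spectral_radius[OF A_alpha_carrier[OF pair_finite_verts]])
      (auto simp: A_alpha_index[OF pair_finite_verts])
qed

lemma spectral_radius_le_alpha_form:
  assumes fin: "finite (pverts G)" and ne: "pverts G \<noteq> {}" and alpha: "0 \<le> \<alpha>" "\<alpha> \<le> 1"
  shows "\<exists>f. (\<forall>u. 0 \<le> f u) \<and> 0 < (\<Sum>u\<in>pverts G. (f u)\<^sup>2) \<and>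
    A_alpha_spectral_radius \<alpha> G * (\<Sum>u\<in>pverts G. (f u)\<^sup>2)
      \<le> (\<Sum>u\<in>pverts G. \<Sum>v\<in>pverts G. alpha_weight \<alpha> G u v * (f u * f v))"
proof -
  let ?n = "card (pverts G)" and ?v = "nth (vertex_list G)"
  have n: "?n > 0" using fin ne by (simp add: card_gt_0_iff)
  have "0 \<le> alpha_weight \<alpha> G u v" for u v using alpha by (simp add: alpha_weight_def)
  then have "0 \<le> A_alpha \<alpha> G $$ (i, j)" if "i < ?n" "j < ?n" for i j
    using A_alpha_index[OF fin that] by simp
  from spectral_radius_le_rayleigh[OF A_alpha_carrier[OF fin] n this]
  obtain x where x: "x \<in> carrier_vec ?n" "\<forall>i<?n. 0 \<le> x $ i" "0 < x \<bullet> x"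
    "spectral_radius (map_mat complex_of_real (A_alpha \<alpha> G)) * (x \<bullet> x) \<le> x \<bullet> (A_alpha \<alpha> G *\<^sub>v x)"
    by blast
  \<comment> \<open>The absolute value makes \<open>f\<close> nonnegative also outside the graph,
    where the inverse is unspecified; on vertices it changes nothing.\<close>
  define f where "f u = \<bar>x $ the_inv_into {..<?n} ?v u\<bar>" for u
  have "f (?v i) = x $ i" if "i < ?n" for i
    using that x(2) the_inv_into_f_f[OF bij_betw_imp_inj_on[OF bij_betw_vertex_list[OF fin]], of i]
    by (simp add: f_def)
  then have xf: "x = vec ?n (\<lambda>i. f (?v i))" using x(1) by (intro eq_vecI) auto
  have "0 \<le> f u" for u by (simp add: f_def)
  then show ?thesis
    using x(3,4) unfolding xf A_alpha_quadratic_form[OF fin] vertex_list_norm[OF fin]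
      A_alpha_spectral_radius_def by blast
qed

section \<open>The BFS tree\<close>

text \<open>Extends \<open>bfs_offset\<close> to \<open>i = 0\<close>, when only the root, numbered
  0, has been used. The children of every vertex, the root included, then fill the interval between
  two successive values.\<close>

definition bfs_last_used :: "nat list \<Rightarrow> nat \<Rightarrow> nat" where
  "bfs_last_used \<pi> i = (if i = 0 then 0 else bfs_offset \<pi> i)"

text \<open>Children are handed out in consecutive intervals, so the parent of \<open>j\<close> is
  the first vertex after whose turn \<open>j\<close> has been used. The root gets the dummy value
  0.\<close>

definition bfs_parent :: "nat list \<Rightarrow> nat \<Rightarrow> nat" where
  "bfs_parent \<pi> j = (LEAST i. j \<le> bfs_last_used \<pi> (Suc i))"

lemma bfs_offset_Suc: "1 \<le> i \<Longrightarrow> bfs_offset \<pi> (Suc i) = bfs_offset \<pi> i + (\<pi> ! i - 1)"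
  by (cases i) (simp_all add: bfs_offset_def)

lemma bfs_last_used_Suc:
  "bfs_last_used \<pi> (Suc i) = bfs_last_used \<pi> i + (if i = 0 then \<pi> ! 0 else \<pi> ! i - 1)"
  by (simp add: bfs_last_used_def bfs_offset_Suc) (simp add: bfs_offset_def)

lemma mono_bfs_last_used: "i \<le> j \<Longrightarrow> bfs_last_used \<pi> i \<le> bfs_last_used \<pi> j"
  by (rule lift_Suc_mono_le[of "bfs_last_used \<pi>"]) (simp_all add: bfs_last_used_Suc)

text \<open>The arithmetic that a degree list inherits from a tree. A one-vertex tree has degree
  list \<open>[0]\<close>, hence the guard on positivity.\<close>

locale tree_degree_list =
  fixes \<pi> :: "nat list"
  assumes nonempty: "1 \<le> length \<pi>"
    and nonincreasing: "sorted_wrt (\<ge>) \<pi>"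
    and sum_eq: "(\<Sum>i<length \<pi>. \<pi> ! i) + 2 = 2 * length \<pi>"
    and positive: "2 \<le> length \<pi> \<Longrightarrow> i < length \<pi> \<Longrightarrow> 1 \<le> \<pi> ! i"
begin

lemma nth_antimono: "i \<le> j \<Longrightarrow> j < length \<pi> \<Longrightarrow> \<pi> ! j \<le> \<pi> ! i"
  using sorted_wrt_nth_less[OF nonincreasing, of i j] by (cases "i = j") auto

lemma bfs_children_eq:
  assumes "i < length \<pi>"
  shows "bfs_children \<pi> i = {bfs_last_used \<pi> i <.. bfs_last_used \<pi> (Suc i)}"
proof (cases "i = 0")
  case False
  then have "1 \<le> \<pi> ! i" using positive[of i] assms by simp
  then show ?thesis using False
    by (auto simp: bfs_children_def bfs_last_used_Suc) (auto simp: bfs_last_used_def)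
qed (auto simp: bfs_children_def bfs_last_used_def bfs_offset_def)

text \<open>Each of the first \<open>i\<close> vertices other than the root spends one unit of its
  degree on its parent; the rest of the degree sum counts children.\<close>

lemma bfs_last_used_sum:
  assumes "1 \<le> i" "i \<le> length \<pi>"
  shows "bfs_last_used \<pi> i + i = (\<Sum>j<i. \<pi> ! j) + 1"
  using assms
proof (induction i rule: dec_induct)
  case base
  show ?case by (simp add: bfs_last_used_def bfs_offset_def)
next
  case (step i)
  then have "1 \<le> \<pi> ! i" using positive[of i] by simp
  then show ?case using step by (simp add: bfs_last_used_Suc)
qed

lemma bfs_last_used_length: "bfs_last_used \<pi> (length \<pi>) = length \<pi> - 1"
  using bfs_last_used_sum[OF nonempty] sum_eq by linarith

text \<open>If \<open>\<pi> ! (i - 1) \<ge> 2\<close>, each of the first \<open>i\<close> degrees is at least 2; otherwise all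
  later degrees are at most 1 and the total \<open>2 (n - 1)\<close> leaves enough for the first \<open>i\<close>.\<close>

lemma le_bfs_last_used:
  assumes "1 \<le> i" "i < length \<pi>"
  shows "i \<le> bfs_last_used \<pi> i"
proof -
  have "2 * i \<le> (\<Sum>j<i. \<pi> ! j) + 1"
  proof (cases "2 \<le> \<pi> ! (i - 1)")
    case True
    then have "2 \<le> \<pi> ! j" if "j < i" for j
      using order_trans[OF _ nth_antimono[of j "i - 1"]] that assms by simp
    then have "(\<Sum>j<i. 2) \<le> (\<Sum>j<i. \<pi> ! j)" by (intro sum_mono) auto
    then show ?thesis by simp
  next
    case False
    then have "\<pi> ! j \<le> 1" if "i \<le> j" "j < length \<pi>" for j
      using order_trans[OF nth_antimono[of "i - 1" j]] that by simp
    then have "(\<Sum>j = i..<length \<pi>. \<pi> ! j) \<le> (\<Sum>j = i..<length \<pi>. 1)" by (intro sum_mono) auto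
    moreover have "(\<Sum>j<length \<pi>. \<pi> ! j) = (\<Sum>j<i. \<pi> ! j) + (\<Sum>j = i..<length \<pi>. \<pi> ! j)"
      using assms by (simp add: lessThan_atLeast0 sum.atLeastLessThan_concat)
    ultimately show ?thesis using sum_eq assms by simp
  qed
  then show ?thesis using bfs_last_used_sum[of i] assms by simp
qed

text \<open>The thresholds \<open>bfs_last_used\<close> are monotone, so the least index is below
  \<open>s\<close> as soon as threshold \<open>s\<close> reaches \<open>j\<close>. Thus the children
  of an initial segment form an interval, which makes them easy to count.\<close>

lemma bfs_parent_less_iff:
  assumes "1 \<le> j" "j < length \<pi>"
  shows "bfs_parent \<pi> j < s \<longleftrightarrow> j \<le> bfs_last_used \<pi> s"
proof
  \<comment> \<open>After the turn of the last vertex all numbers up to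
    \<open>length \<pi> - 1\<close> are used; this witness makes the \<open>LEAST\<close> well
    defined.\<close>
  have "j \<le> bfs_last_used \<pi> (Suc (length \<pi> - 1))"
    using bfs_last_used_length assms by (cases "length \<pi>") auto
  then have "j \<le> bfs_last_used \<pi> (Suc (bfs_parent \<pi> j))"
    unfolding bfs_parent_def by (rule LeastI)
  then show "j \<le> bfs_last_used \<pi> s" if "bfs_parent \<pi> j < s"
    using mono_bfs_last_used[of "Suc (bfs_parent \<pi> j)" s \<pi>] that by simp
next
  assume le: "j \<le> bfs_last_used \<pi> s"
  then have "s \<noteq> 0" using assms by (cases "s = 0") (auto simp: bfs_last_used_def)
  then obtain r where r: "s = Suc r" by (cases s) auto
  then have "bfs_parent \<pi> j \<le> r" using le unfolding bfs_parent_def by (intro Least_le) simp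
  then show "bfs_parent \<pi> j < s" using r by simp
qed

lemma bfs_parent_less: "1 \<le> j \<Longrightarrow> j < length \<pi> \<Longrightarrow> bfs_parent \<pi> j < j"
  by (simp add: bfs_parent_less_iff le_bfs_last_used)

lemma bfs_children_iff:
  assumes "i < length \<pi>"
  shows "j \<in> bfs_children \<pi> i \<longleftrightarrow> 1 \<le> j \<and> j < length \<pi> \<and> i = bfs_parent \<pi> j"
proof -
  have "bfs_last_used \<pi> (Suc i) \<le> length \<pi> - 1"
    using mono_bfs_last_used[of "Suc i" "length \<pi>" \<pi>] bfs_last_used_length assms by simp
  then have range: "1 \<le> j \<and> j < length \<pi>" if "j \<in> bfs_children \<pi> i"
    using that assms by (auto simp: bfs_children_eq)
  \<comment> \<open>The parent equals \<open>i\<close> iff it is below \<open>Suc i\<close> but not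
    below \<open>i\<close>, which is a pair of threshold conditions.\<close>
  have "j \<in> bfs_children \<pi> i \<longleftrightarrow> i = bfs_parent \<pi> j" if "1 \<le> j" "j < length \<pi>"
    using bfs_parent_less_iff[OF that, of i] bfs_parent_less_iff[OF that, of "Suc i"] assms
    by (auto simp: bfs_children_eq)
  with range show ?thesis by blast
qed

lemma pverts_bfs_tree [simp]: "pverts (bfs_tree \<pi>) = {..<length \<pi>}"
  by (simp add: bfs_tree_def Let_def)

lemma parcs_bfs_tree_iff:
  "(i, j) \<in> parcs (bfs_tree \<pi>) \<longleftrightarrow>
     1 \<le> j \<and> j < length \<pi> \<and> i = bfs_parent \<pi> j \<or> 1 \<le> i \<and> i < length \<pi> \<and> j = bfs_parent \<pi> i"
proof -
  have "(i, j) \<in> parcs (bfs_tree \<pi>) \<longleftrightarrow>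
      i < length \<pi> \<and> j \<in> bfs_children \<pi> i \<or> j < length \<pi> \<and> i \<in> bfs_children \<pi> j"
    by (auto simp: bfs_tree_def Let_def)
  also have "\<dots> \<longleftrightarrow> i < length \<pi> \<and> 1 \<le> j \<and> j < length \<pi> \<and> i = bfs_parent \<pi> j \<or>
      j < length \<pi> \<and> 1 \<le> i \<and> i < length \<pi> \<and> j = bfs_parent \<pi> i"
    by (simp add: bfs_children_iff cong: conj_cong)
  also have "\<dots> \<longleftrightarrow> 1 \<le> j \<and> j < length \<pi> \<and> i = bfs_parent \<pi> j \<or>
      1 \<le> i \<and> i < length \<pi> \<and> j = bfs_parent \<pi> i"
    using bfs_parent_less[of i] bfs_parent_less[of j] by (meson less_trans)
  finally show ?thesis .
qed

lemma parcs_bfs_treeD: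
  assumes "(i, j) \<in> parcs (bfs_tree \<pi>)"
  shows "i < length \<pi>" "j < length \<pi>" "i \<noteq> j"
  using assms bfs_parent_less[of i] bfs_parent_less[of j] unfolding parcs_bfs_tree_iff by auto

lemma pair_graph_bfs_tree: "pair_graph (bfs_tree \<pi>)"
proof unfold_locales
  show "fst e \<in> pverts (bfs_tree \<pi>)" "snd e \<in> pverts (bfs_tree \<pi>)" "fst e \<noteq> snd e"
    if "e \<in> parcs (bfs_tree \<pi>)" for e
    using that parcs_bfs_treeD[of "fst e" "snd e"] by auto
  show "finite (pverts (bfs_tree \<pi>))" by simp
  have "parcs (bfs_tree \<pi>) \<subseteq> {..<length \<pi>} \<times> {..<length \<pi>}" using parcs_bfs_treeD by auto
  then show "finite (parcs (bfs_tree \<pi>))" by (rule finite_subset) simp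
  show "symmetric (with_proj (bfs_tree \<pi>))"
    unfolding symmetric_def by (auto intro!: symI simp: parcs_bfs_tree_iff)
qed

lemma connected_bfs_tree: "Digraph_Component.connected (with_proj (bfs_tree \<pi>))"
proof -
  interpret pair_graph "bfs_tree \<pi>" by (rule pair_graph_bfs_tree)
  have sym: "mk_symmetric (with_proj (bfs_tree \<pi>)) = bfs_tree \<pi>"
    by (force simp: mk_symmetric_def arcs_commute intro!: pair_pre_digraph.equality)
  \<comment> \<open>Every vertex is reached from the root through its parent, which has a smaller
    number; symmetry then joins any two vertices.\<close>
  have root: "0 \<rightarrow>\<^sup>*\<^bsub>with_proj (bfs_tree \<pi>)\<^esub> j" if "j < length \<pi>" for j
    using that
  proof (induction j rule: less_induct)
    case (less j)
    show ?case
    proof (cases "j = 0")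
      case True
      then show ?thesis using less.prems by (auto intro: reachable_refl)
    next
      case False
      then have p: "bfs_parent \<pi> j < j" using bfs_parent_less less.prems by simp
      then have "0 \<rightarrow>\<^sup>*\<^bsub>with_proj (bfs_tree \<pi>)\<^esub> bfs_parent \<pi> j" using less by simp
      moreover have "(bfs_parent \<pi> j, j) \<in> parcs (bfs_tree \<pi>)"
        using False less.prems by (simp add: parcs_bfs_tree_iff)
      ultimately show ?thesis using reachable_adj_trans by simp
    qed
  qed
  have "i \<rightarrow>\<^sup>*\<^bsub>with_proj (bfs_tree \<pi>)\<^esub> j" if "i < length \<pi>" "j < length \<pi>" for i j
    using reachable_trans symmetric_reachable' root that by metis
  then show ?thesis using nonempty
    by (auto simp: connected_def strongly_connected_def sym lessThan_empty_iff)
qed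

end

section \<open>Cycles, degrees and arc counts in the BFS tree\<close>

lemma pcas_successive:
  assumes "pcas u p v"
  shows "pawalk_verts u p = u # map snd p"
    and "i < length p \<Longrightarrow> fst (p ! i) = (if i = 0 then u else snd (p ! (i - 1)))"
    and "p \<noteq> [] \<Longrightarrow> snd (last p) = v"
proof -
  show "pawalk_verts u p = u # map snd p"
    using assms by (induction p arbitrary: u) auto
  show "i < length p \<Longrightarrow> fst (p ! i) = (if i = 0 then u else snd (p ! (i - 1)))"
    using assms
  proof (induction p arbitrary: u i)
    case (Cons e p)
    show ?case
    proof (cases i)
      case (Suc k)
      then show ?thesis using Cons.IH[of k "snd e"] Cons.prems by (cases k) auto
    qed (use Cons in auto)
  qed simp
  show "p \<noteq> [] \<Longrightarrow> snd (last p) = v"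
    using assms by (induction p arbitrary: u) auto
qed

lemma cycle_two_neighbours:
  assumes cyc: "pre_digraph.cycle (with_proj G) p" and len: "3 \<le> length p" and v: "v \<in> snd ` set p"
  shows "\<exists>a\<in>snd ` set p. \<exists>b\<in>snd ` set p. a \<noteq> b \<and> (a, v) \<in> parcs G \<and> (v, b) \<in> parcs G"
proof -
  interpret pair_pre_digraph G .
  obtain u where arcs: "set p \<subseteq> parcs G" and cas: "pcas u p u"
    and dist: "distinct (tl (pawalk_verts u p))" and ne: "p \<noteq> []"
    using cyc by (auto simp: cycle_def awalk_def)
  have inj: "snd (p ! i) = snd (p ! j) \<longleftrightarrow> i = j" if "i < length p" "j < length p" for i j
    using dist that nth_eq_iff_index_eq[of "map snd p" i j]
    by (simp add: pcas_successive(1)[OF cas])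
  have fst_eq: "fst (p ! i) = snd (p ! (if i = 0 then length p - 1 else i - 1))" if "i < length p" for i
    using pcas_successive(2)[OF cas that] pcas_successive(3)[OF cas ne] ne by (simp add: last_conv_nth)
  obtain k where k: "k < length p" "v = snd (p ! k)" using v by (auto simp: in_set_conv_nth)
  \<comment> \<open>Cyclic predecessor and successor of the position \<open>k\<close>; they differ
    because the cycle has at least 3 arcs.\<close>
  define a b where "a = (if k = 0 then length p - 1 else k - 1)"
    and "b = (if k = length p - 1 then 0 else k + 1)"
  have ab: "a < length p" "b < length p" "a \<noteq> b" using k len by (auto simp: a_def b_def split: if_splits)
  have "(snd (p ! a), v) = p ! k" using fst_eq[OF k(1)] k by (simp add: a_def prod_eq_iff)
  moreover have "fst (p ! b) = v" using fst_eq[OF ab(2)] k len by (auto simp: b_def split: if_splits)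
  then have "(v, snd (p ! b)) = p ! b" by (simp add: prod_eq_iff)
  ultimately have "(snd (p ! a), v) \<in> parcs G" "(v, snd (p ! b)) \<in> parcs G"
    using arcs k ab by (metis nth_mem subsetD)+
  then show ?thesis using ab inj[of a b] by (meson image_eqI nth_mem)
qed

context tree_degree_list
begin

text \<open>The largest vertex of a cycle would have two smaller neighbours, hence two parents.\<close>

lemma tree_graph_bfs_tree: "tree_graph (bfs_tree \<pi>)"
proof -
  have False if cyc: "pre_digraph.cycle (with_proj (bfs_tree \<pi>)) p" and len: "3 \<le> length p" for p
  proof -
    define v where "v = Max (snd ` set p)"
    have "v \<in> snd ` set p" unfolding v_def using len by (intro Max_in) auto
    then obtain a b where a: "a \<in> snd ` set p" "(a, v) \<in> parcs (bfs_tree \<pi>)"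
      and b: "b \<in> snd ` set p" "(v, b) \<in> parcs (bfs_tree \<pi>)" and "a \<noteq> b"
      using cycle_two_neighbours[OF cyc len] by blast
    have "a \<le> v" "b \<le> v" unfolding v_def using a b by auto
    then have "a = bfs_parent \<pi> v" "b = bfs_parent \<pi> v"
      using a(2) b(2) bfs_parent_less[of a] bfs_parent_less[of b] unfolding parcs_bfs_tree_iff by auto
    then show False using \<open>a \<noteq> b\<close> by simp
  qed
  then show ?thesis
    using pair_graph_bfs_tree connected_bfs_tree unfolding tree_graph_def by blast
qed

lemma out_degree_bfs_tree:
  assumes i: "i < length \<pi>"
  shows "out_degree (with_proj (bfs_tree \<pi>)) i = \<pi> ! i"
proof -
  interpret pair_graph "bfs_tree \<pi>" by (rule pair_graph_bfs_tree)
  \<comment> \<open>The neighbours are the children and, except at the root, the parent; this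
    restores the 1 subtracted from the number of children.\<close>
  have "{j. (i, j) \<in> parcs (bfs_tree \<pi>)} = bfs_children \<pi> i \<union> (if i = 0 then {} else {bfs_parent \<pi> i})"
    using i by (auto simp: parcs_bfs_tree_iff bfs_children_iff)
  moreover have "bfs_parent \<pi> i \<notin> bfs_children \<pi> i" if "i \<noteq> 0"
    using bfs_parent_less[of i] bfs_parent_less[of "bfs_parent \<pi> i"] that i
    by (auto simp: bfs_children_iff)
  moreover have "card (bfs_children \<pi> i) = (if i = 0 then \<pi> ! 0 else \<pi> ! i - 1)"
    using i by (simp add: bfs_children_eq bfs_last_used_Suc)
  moreover have "finite (bfs_children \<pi> i)" using i by (simp add: bfs_children_eq)
  moreover have "1 \<le> \<pi> ! i" if "i \<noteq> 0" using positive[of i] that i by simp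
  ultimately show ?thesis by (auto simp: out_degree_eq_card)
qed

lemma has_degree_sequence_bfs_tree: "has_degree_sequence (bfs_tree \<pi>) \<pi>"
proof -
  have "mset \<pi> = mset (map (nth \<pi>) [0..<length \<pi>])" by (simp add: map_nth)
  also have "\<dots> = image_mset (nth \<pi>) (mset_set {..<length \<pi>})"
    by (simp add: mset_set_upto_eq_mset_upto)
  also have "\<dots> = image_mset (out_degree (with_proj (bfs_tree \<pi>))) (mset_set {..<length \<pi>})"
    by (intro image_mset_cong) (simp add: out_degree_bfs_tree)
  finally show ?thesis by (simp add: has_degree_sequence_def)
qed

text \<open>The arcs counted are \<open>(parent j, j)\<close> with \<open>parent j < s\<close> and \<open>j < t\<close>, and \<open>(j, parent j)\<close>
  with \<open>j < s\<close>.\<close>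

lemma bfs_tree_arcs_between:
  assumes st: "1 \<le> s" "s \<le> t" "t \<le> length \<pi>"
  shows "min ((\<Sum>i<s. \<pi> ! i) + 2) (s + t) \<le> card (arcs_between (parcs (bfs_tree \<pi>)) {..<s} {..<t}) + 2"
proof -
  let ?p = "bfs_parent \<pi>"
  define D where "D = (\<lambda>j. (?p j, j)) ` {1..min (bfs_last_used \<pi> s) (t - 1)}"
  define U where "U = (\<lambda>j. (j, ?p j)) ` {1..<s}"
  have less: "?p j < j" if "1 \<le> j" "j < t" for j using bfs_parent_less[of j] that st by simp
  have "D \<subseteq> arcs_between (parcs (bfs_tree \<pi>)) {..<s} {..<t}"
  proof
    fix e assume "e \<in> D"
    then obtain j where j: "e = (?p j, j)" "1 \<le> j" "j \<le> bfs_last_used \<pi> s" "j \<le> t - 1"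
      by (auto simp: D_def)
    then have "j < t" "j < length \<pi>" using st by auto
    then show "e \<in> arcs_between (parcs (bfs_tree \<pi>)) {..<s} {..<t}"
      using j bfs_parent_less_iff[of j s] by (simp add: arcs_between_def parcs_bfs_tree_iff)
  qed
  moreover have "U \<subseteq> arcs_between (parcs (bfs_tree \<pi>)) {..<s} {..<t}"
  proof
    fix e assume "e \<in> U"
    then obtain j where j: "e = (j, ?p j)" "1 \<le> j" "j < s" by (auto simp: U_def)
    then show "e \<in> arcs_between (parcs (bfs_tree \<pi>)) {..<s} {..<t}"
      using less[of j] st by (simp add: arcs_between_def parcs_bfs_tree_iff)
  qed
  ultimately have "card (D \<union> U) \<le> card (arcs_between (parcs (bfs_tree \<pi>)) {..<s} {..<t})"
    by (intro card_mono) auto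
  \<comment> \<open>A common arc would make each end the parent of the other, yet parents have
    smaller numbers.\<close>
  moreover have "D \<inter> U = {}"
  proof (rule equals0I)
    fix e assume "e \<in> D \<inter> U"
    then have e: "1 \<le> snd e" "snd e \<le> t - 1" "fst e = ?p (snd e)"
      "1 \<le> fst e" "fst e < s" "snd e = ?p (fst e)"
      by (auto simp: D_def U_def)
    have "?p (snd e) < snd e" by (rule less[OF e(1)]) (use e(2) st in linarith)
    moreover have "?p (fst e) < fst e" by (rule less[OF e(4)]) (use e(5) st in linarith)
    ultimately show False using e(3,6) by linarith
  qed
  then have "card (D \<union> U) = card D + card U" by (intro card_Un_disjoint) (auto simp: D_def U_def)
  moreover have "card D = min (bfs_last_used \<pi> s) (t - 1)" "card U = s - 1"
    unfolding D_def U_def by (simp_all add: card_image inj_on_def)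
  \<comment> \<open>Adding \<open>s - 1\<close> upward arcs and 2 turns
    \<open>bfs_last_used \<pi> s\<close> into the degree sum plus 2, and \<open>t - 1\<close> into
    \<open>s + t\<close>: the two arguments of the minimum.\<close>
  moreover have "bfs_last_used \<pi> s + s = (\<Sum>i<s. \<pi> ! i) + 1" using bfs_last_used_sum[of s] st by simp
  ultimately show ?thesis using st by linarith
qed

end

section \<open>Comparison of quadratic forms\<close>

text \<open>Abel summation as an induction: the partial sums of \<open>b - a\<close> are nonnegative
  and the weights decrease, so the weighted sum up to \<open>k\<close> is at least
  \<open>y k\<close> times the plain one.\<close>

lemma weighted_sum_mono:
  fixes a b y :: "nat \<Rightarrow> real"
  assumes partial: "\<And>s. s \<le> n \<Longrightarrow> (\<Sum>i<s. a i) \<le> (\<Sum>i<s. b i)"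
    and anti: "\<And>i j. i \<le> j \<Longrightarrow> j < n \<Longrightarrow> y j \<le> y i" and nonneg: "\<And>i. i < n \<Longrightarrow> 0 \<le> y i"
  shows "(\<Sum>i<n. a i * y i) \<le> (\<Sum>i<n. b i * y i)"
proof (cases n)
  case (Suc m)
  let ?c = "\<lambda>i. b i - a i"
  have "y k * (\<Sum>i<Suc k. ?c i) \<le> (\<Sum>i<Suc k. ?c i * y i)" if "k < n" for k
    using that
  proof (induction k)
    case (Suc k)
    have "0 \<le> (\<Sum>i<Suc k. ?c i)"
      using partial[of "Suc k"] Suc.prems by (simp only: sum_subtractf less_imp_le diff_ge_0_iff_ge)
    then have "y (Suc k) * (\<Sum>i<Suc k. ?c i) \<le> y k * (\<Sum>i<Suc k. ?c i)"
      using anti[of k "Suc k"] Suc.prems by (intro mult_right_mono) auto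
    also have "\<dots> \<le> (\<Sum>i<Suc k. ?c i * y i)" using Suc by simp
    finally show ?case unfolding sum.lessThan_Suc[of _ "Suc k"] distrib_left by (simp only: mult.commute)
  qed simp
  from this[of m] have "y m * (\<Sum>i<n. ?c i) \<le> (\<Sum>i<n. ?c i * y i)" using Suc by simp
  moreover have "0 \<le> y m * (\<Sum>i<n. ?c i)"
    using nonneg[of m] partial[of n] Suc by (intro mult_nonneg_nonneg) (simp_all add: sum_subtractf)
  ultimately have "0 \<le> (\<Sum>i<n. ?c i * y i)" by linarith
  then show ?thesis by (simp add: left_diff_distrib sum_subtractf)
qed simp

text \<open>One-dimensional Abel summation is applied twice: first over columns with an initial
  segment of rows fixed, then over rows to the resulting weighted row sums.\<close>

lemma quadratic_form_mono:
  fixes M N :: "nat \<Rightarrow> nat \<Rightarrow> real"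
  assumes blocks: "\<And>s t. s \<le> n \<Longrightarrow> t \<le> n \<Longrightarrow> (\<Sum>i<s. \<Sum>j<t. M i j) \<le> (\<Sum>i<s. \<Sum>j<t. N i j)"
    and anti: "\<And>i j. i \<le> j \<Longrightarrow> j < n \<Longrightarrow> y j \<le> y i" and nonneg: "\<And>i. i < n \<Longrightarrow> 0 \<le> y i"
  shows "(\<Sum>i<n. \<Sum>j<n. M i j * (y i * y j)) \<le> (\<Sum>i<n. \<Sum>j<n. N i j * (y i * y j))"
proof -
  have "(\<Sum>i<s. \<Sum>j<n. M i j * y j) \<le> (\<Sum>i<s. \<Sum>j<n. N i j * y j)" if "s \<le> n" for s
  proof -
    have "(\<Sum>j<n. (\<Sum>i<s. M i j) * y j) \<le> (\<Sum>j<n. (\<Sum>i<s. N i j) * y j)"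
    proof (rule weighted_sum_mono)
      show "(\<Sum>j<t. \<Sum>i<s. M i j) \<le> (\<Sum>j<t. \<Sum>i<s. N i j)" if "t \<le> n" for t
        using blocks[OF \<open>s \<le> n\<close> that] by (subst (1 2) sum.swap) simp
    qed (use anti nonneg in auto)
    then show ?thesis by (subst (1 2) sum.swap) (simp add: sum_distrib_right)
  qed
  then have "(\<Sum>i<n. (\<Sum>j<n. M i j * y j) * y i) \<le> (\<Sum>i<n. (\<Sum>j<n. N i j * y j) * y i)"
    using anti nonneg by (intro weighted_sum_mono) auto
  then show ?thesis by (simp add: sum_distrib_left sum_distrib_right mult_ac)
qed

lemma antitone_enumeration:
  fixes f :: "'a \<Rightarrow> real"
  assumes "finite V"
  shows "\<exists>v. bij_betw v {..<card V} V \<and> (\<forall>i j. i \<le> j \<longrightarrow> j < card V \<longrightarrow> f (v j) \<le> f (v i))"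
proof -
  obtain xs where xs: "distinct xs" "set xs = V" using finite_distinct_list[OF assms] by blast
  define vs where "vs = sort_key (\<lambda>u. - f u) xs"
  have vs: "distinct vs" "set vs = V" "sorted (map (\<lambda>u. - f u) vs)"
    using xs by (simp_all add: vs_def)
  have len: "length vs = card V" using vs distinct_card by metis
  have "f (vs ! j) \<le> f (vs ! i)" if "i \<le> j" "j < card V" for i j
    using sorted_nth_mono[OF vs(3), of i j] that len by simp
  moreover have "bij_betw (nth vs) {..<card V} V" using bij_betw_nth vs len by metis
  ultimately show ?thesis by blast
qed

section \<open>Block sums and comparison with the BFS tree\<close>

lemma alpha_weight_sum:
  assumes U: "finite U" and S: "S \<subseteq> U"
  shows "(\<Sum>u\<in>S. \<Sum>v\<in>U. alpha_weight \<alpha> G u v) =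
    \<alpha> * real (\<Sum>u\<in>S. out_degree (with_proj G) u) + (1 - \<alpha>) * real (card (arcs_between (parcs G) S U))"
proof -
  have finS: "finite S" using S U by (rule finite_subset)
  \<comment> \<open>As \<open>S \<subseteq> U\<close>, the diagonal entry of every row in
    \<open>S\<close> lies inside the block.\<close>
  have diag: "(\<Sum>v\<in>U. if u = v then real (out_degree (with_proj G) u) else 0) =
      real (out_degree (with_proj G) u)" if "u \<in> S" for u
    using that S U by (subst sum.delta') auto
  have "(\<Sum>u\<in>S. \<Sum>v\<in>U. if (u, v) \<in> parcs G then 1 else 0) =
      (\<Sum>e\<in>S \<times> U. if e \<in> parcs G then 1 else (0::real))"
    by (simp add: sum.cartesian_product case_prod_unfold)
  also have "\<dots> = real (card (arcs_between (parcs G) S U))"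
    using finS U by (simp add: arcs_between_def sum.If_cases Int_commute)
  finally have off: "(\<Sum>u\<in>S. \<Sum>v\<in>U. if (u, v) \<in> parcs G then 1 else 0) =
      real (card (arcs_between (parcs G) S U))" .
  show ?thesis
    by (simp add: alpha_weight_def sum.distrib diag flip: sum_distrib_left off)
qed

text \<open>Diagonal and adjacency parts are compared separately: the BFS tree has the
  \<open>s\<close> largest degrees on its first \<open>s\<close> vertices, and its block has at
  least as many arcs as the smaller of the two bounds valid for \<open>T\<close>.\<close>

lemma alpha_weight_block_le_bfs_tree:
  assumes T: "tree_graph T" and seq: "has_degree_sequence T \<pi>" and mono: "sorted_wrt (\<ge>) \<pi>"
    and alpha: "0 \<le> \<alpha>" "\<alpha> \<le> 1" and v: "bij_betw v {..<length \<pi>} (pverts T)"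
    and st: "s \<le> t" "t \<le> length \<pi>"
  shows "(\<Sum>i<s. \<Sum>j<t. alpha_weight \<alpha> T (v i) (v j)) \<le> (\<Sum>i<s. \<Sum>j<t. alpha_weight \<alpha> (bfs_tree \<pi>) i j)"
\<comment> \<open>The bound \<open>s + t - 2\<close> requires a nonempty row set; an empty one makes
  both sums 0.\<close>
proof (cases "s = 0")
  case False
  interpret pair_graph T using T by (simp add: tree_graph_def)
  interpret tree_degree_list \<pi>
    using tree_degree_sequence[OF T seq] mono by unfold_locales auto
  let ?S = "v ` {..<s}" and ?U = "v ` {..<t}"
  have sub: "?S \<subseteq> ?U" "?U \<subseteq> pverts T" using v st by (auto simp: bij_betw_def)
  have inj: "inj_on v {..<s}" "inj_on v {..<t}"
    using v st by (auto simp: bij_betw_def inj_on_def)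
  have card: "card ?S = s" "card ?U = t" using inj by (simp_all add: card_image)
  have deg: "(\<Sum>u\<in>?S. out_degree (with_proj T) u) \<le> (\<Sum>i<s. \<pi> ! i)"
    using sum_out_degree_le_initial[OF pair_finite_verts seq mono, of ?S] sub card by auto
  have "card (arcs_between (parcs T) ?S ?U) \<le> card (arcs_between (parcs T) ?S (pverts T))"
    using sub pair_finite_verts finite_subset[of ?S]
    by (intro card_mono) (auto simp: arcs_between_def)
  also have "\<dots> = (\<Sum>u\<in>?S. out_degree (with_proj T) u)" using sum_out_degree sub by (metis subset_trans)
  finally have "card (arcs_between (parcs T) ?S ?U) \<le> (\<Sum>i<s. \<pi> ! i)" using deg by linarith
  moreover have "card (arcs_between (parcs T) ?S ?U) + 2 \<le> s + t"
    using tree_arcs_between[OF T sub(2,1)] card False by auto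
  ultimately have arcs: "card (arcs_between (parcs T) ?S ?U)
      \<le> card (arcs_between (parcs (bfs_tree \<pi>)) {..<s} {..<t})"
    using bfs_tree_arcs_between[of s t] st False by simp
  have "(\<Sum>i<s. \<Sum>j<t. alpha_weight \<alpha> T (v i) (v j)) = (\<Sum>u\<in>?S. \<Sum>w\<in>?U. alpha_weight \<alpha> T u w)"
    by (simp add: sum.reindex inj)
  also have "\<dots> = \<alpha> * real (\<Sum>u\<in>?S. out_degree (with_proj T) u) +
      (1 - \<alpha>) * real (card (arcs_between (parcs T) ?S ?U))"
    using sub by (intro alpha_weight_sum) auto
  also have "\<dots> \<le> \<alpha> * real (\<Sum>i<s. \<pi> ! i) +
      (1 - \<alpha>) * real (card (arcs_between (parcs (bfs_tree \<pi>)) {..<s} {..<t}))"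
    using deg arcs alpha by (intro add_mono mult_left_mono of_nat_mono) auto
  also have "(\<Sum>i<s. \<pi> ! i) = (\<Sum>i<s. out_degree (with_proj (bfs_tree \<pi>)) i)"
    using st by (intro sum.cong) (simp_all add: out_degree_bfs_tree)
  also have "\<alpha> * real (\<Sum>i<s. out_degree (with_proj (bfs_tree \<pi>)) i) +
      (1 - \<alpha>) * real (card (arcs_between (parcs (bfs_tree \<pi>)) {..<s} {..<t})) =
      (\<Sum>i<s. \<Sum>j<t. alpha_weight \<alpha> (bfs_tree \<pi>) i j)"
    using st by (intro alpha_weight_sum[symmetric]) auto
  finally show ?thesis .
qed simp

lemma alpha_weight_commute: "pair_graph G \<Longrightarrow> alpha_weight \<alpha> G u v = alpha_weight \<alpha> G v u"
  unfolding alpha_weight_def by (simp add: pair_graph.arcs_commute[of G u v])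

text \<open>A nonnegative test vector for \<open>T\<close> is transplanted: vertex \<open>i\<close>
  of the BFS tree receives the \<open>i\<close>-th largest value, counting from 0. The norm is
  unchanged and the form does not decrease.\<close>

lemma spectral_radius_le_bfs_tree:
  assumes T: "tree_graph T" and seq: "has_degree_sequence T \<pi>" and mono: "sorted_wrt (\<ge>) \<pi>"
    and alpha: "0 \<le> \<alpha>" "\<alpha> \<le> 1"
  shows "A_alpha_spectral_radius \<alpha> T \<le> A_alpha_spectral_radius \<alpha> (bfs_tree \<pi>)"
proof -
  interpret T: pair_graph T using T by (simp add: tree_graph_def)
  note tds = tree_degree_sequence[OF T seq]
  interpret tree_degree_list \<pi> using tds mono by unfold_locales auto
  let ?n = "length \<pi>" and ?B = "bfs_tree \<pi>"
  have ne: "pverts T \<noteq> {}" using tds by auto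
  obtain f where f: "\<And>u. 0 \<le> f u" "0 < (\<Sum>u\<in>pverts T. (f u)\<^sup>2)"
    "A_alpha_spectral_radius \<alpha> T * (\<Sum>u\<in>pverts T. (f u)\<^sup>2)
      \<le> (\<Sum>u\<in>pverts T. \<Sum>v\<in>pverts T. alpha_weight \<alpha> T u v * (f u * f v))"
    using spectral_radius_le_alpha_form[OF T.pair_finite_verts ne alpha] by blast
  obtain v where v: "bij_betw v {..<?n} (pverts T)"
    and anti: "\<And>i j. i \<le> j \<Longrightarrow> j < ?n \<Longrightarrow> f (v j) \<le> f (v i)"
    using antitone_enumeration[OF T.pair_finite_verts, of f] tds(1) by auto
  have blocks: "(\<Sum>i<s. \<Sum>j<t. alpha_weight \<alpha> T (v i) (v j)) \<le> (\<Sum>i<s. \<Sum>j<t. alpha_weight \<alpha> ?B i j)"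
    if "s \<le> ?n" "t \<le> ?n" for s t
  proof (cases "s \<le> t")
    case True
    then show ?thesis using alpha_weight_block_le_bfs_tree[OF T seq mono alpha v] that by blast
  next
    \<comment> \<open>Blocks with more rows than columns are transposed, using the symmetry of both
      weights.\<close>
    case False
    then have "(\<Sum>j<t. \<Sum>i<s. alpha_weight \<alpha> T (v j) (v i))
      \<le> (\<Sum>j<t. \<Sum>i<s. alpha_weight \<alpha> ?B j i)"
      using alpha_weight_block_le_bfs_tree[OF T seq mono alpha v, of t s] that by simp
    also have "(\<Sum>j<t. \<Sum>i<s. alpha_weight \<alpha> T (v j) (v i)) = (\<Sum>i<s. \<Sum>j<t. alpha_weight \<alpha> T (v i) (v j))"
      by (subst sum.swap) (intro sum.cong refl alpha_weight_commute[OF T.pair_graph])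
    also have "(\<Sum>j<t. \<Sum>i<s. alpha_weight \<alpha> ?B j i) = (\<Sum>i<s. \<Sum>j<t. alpha_weight \<alpha> ?B i j)"
      by (subst sum.swap) (intro sum.cong refl alpha_weight_commute[OF pair_graph_bfs_tree])
    finally show ?thesis .
  qed
  have norm: "(\<Sum>u\<in>pverts T. (f u)\<^sup>2) = (\<Sum>i<?n. (f (v i))\<^sup>2)"
    by (simp add: sum.reindex_bij_betw[OF v, symmetric])
  have "A_alpha_spectral_radius \<alpha> T * (\<Sum>u\<in>pverts T. (f u)\<^sup>2)
      \<le> (\<Sum>i<?n. \<Sum>j<?n. alpha_weight \<alpha> T (v i) (v j) * (f (v i) * f (v j)))"
    using f(3) by (simp add: sum.reindex_bij_betw[OF v, symmetric])
  also have "\<dots> \<le> (\<Sum>i<?n. \<Sum>j<?n. alpha_weight \<alpha> ?B i j * (f (v i) * f (v j)))"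
    using blocks anti f(1) by (intro quadratic_form_mono)
  also have "\<dots> \<le> A_alpha_spectral_radius \<alpha> ?B * (\<Sum>i<?n. (f (v i))\<^sup>2)"
    using alpha_form_le_spectral_radius[OF pair_graph_bfs_tree, of \<alpha> "f \<circ> v"] by simp
  finally show ?thesis using f(2) unfolding norm by simp
qed

theorem theorem1p1:
  fixes \<pi> :: "nat list" and \<alpha> :: real
  assumes nonincreasing: "sorted_wrt (\<ge>) \<pi>"
    and tree_sequence: "\<exists>S :: nat pair_pre_digraph. tree_graph S \<and> has_degree_sequence S \<pi>"
    and alpha: "0 \<le> \<alpha>" "\<alpha> < 1"
  shows "tree_graph (bfs_tree \<pi>) \<and> has_degree_sequence (bfs_tree \<pi>) \<pi> \<and>
    (\<forall>T :: 'a pair_pre_digraph. tree_graph T \<and> has_degree_sequence T \<pi> \<longrightarrow>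
       A_alpha_spectral_radius \<alpha> (bfs_tree \<pi>) \<ge> A_alpha_spectral_radius \<alpha> T)"
proof -
  \<comment> \<open>The tree over \<open>nat\<close> supplies the arithmetic of \<open>\<pi>\<close>
    even when the type \<open>'a\<close> is too small to carry a tree with this degree
    sequence.\<close>
  obtain S :: "nat pair_pre_digraph" where "tree_graph S" "has_degree_sequence S \<pi>"
    using tree_sequence by blast
  from tree_degree_sequence[OF this] interpret tree_degree_list \<pi>
    using nonincreasing by unfold_locales auto
  show ?thesis
    using tree_graph_bfs_tree has_degree_sequence_bfs_tree
      spectral_radius_le_bfs_tree[OF _ _ assms(1) alpha(1) less_imp_le[OF alpha(2)]] by blast
qed

end
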